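(* Let $\mathcal{H}$ be a Hilbert space of functions on a domain $\Omega$. For $k\in\{1,\dots,N_S\}$ let $S^{(k)}\subseteq\Omega$ be a domain, let $\mathcal{G}^{(k)}$ be a linear differential operator defined on a neighbourhood of $S^{(k)}$, and let $g^{(k)}$ be a function on $S^{(k)}$. Let $\{\boldsymbol{x}_j\}_{j=1}^{\infty}$ be a collection of points in $\bigcup_{k=1}^{N_S}S^{(k)}$ such that $\{\boldsymbol{x}_j\}_{j=1}^{\infty}\cap S^{(k)}$ is dense in $S^{(k)}$ for each $k\in\{1,\dots,N_S\}$. For each $j$ let $\mathcal{F}_j=\mathcal{G}^{(k_j)}$ for some $k_j\in\{1,\dots,N_S\}$ with $\boldsymbol{x}_j\in S^{(k_j)}$, and let $f_j=g^{(k_j)}(\boldsymbol{x}_j)$. For each $\tilde N\in\mathbb{N}$ let $\mathcal{L}^{(\tilde N)}:\mathcal{H}\to\mathbb{C}^{\tilde N}$ be given by $(\mathcal{L}^{(\tilde N)}u)_j=(\mathcal{F}_ju)(\boldsymbol{x}_j)$, $j=1,\dots,\tilde N$. Assume that each $\mathcal{L}^{(\tilde N)}$ is bounded and that $\mathcal{G}^{(k)}u$ is continuous on $S^{(k)}$ for all $u\in\mathcal{H}$ and for each $k\in\{1,\dots,N_S\}$. Then, if it exists, let $u^{(\tilde N)}$ be the unique solution of $$\text{minimize } \|u\|_{\mathcal{H}}\text{ over }u\in\mathcal{H},\quad\text{subject to } (\mathcal{F}_ju)(\boldsymbol{x}_j)=f_j\ \text{ for each } j\in\{1,\dots,\tilde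 N\}.$$ If for each $\tilde N$, $u^{(\tilde N)}$ exists and $\|u^{(\tilde N)}\|_{\mathcal{H}}<B$ for some $B>0$ (the same $B$ for all $\tilde N$), then there exists a solution $u^{(\infty)}\in\mathcal{H}$ to $$\mathcal{G}^{(k)}u^{(\infty)}=g^{(k)}\ \text{ on } S^{(k)},\quad\text{for each }k\in\{1,\dots,N_S\}.$$ Furthermore, $\|u^{(\infty)}-u^{(\tilde N)}\|_{\mathcal{H}}\to0$ as $\tilde N\to\infty$.
   Context: The sets $S^{(k)}$ may have any shape or codimension (for example, $S^{(1)}$ may be a surface and $S^{(2)}=\partial S^{(1)}$). The values $(\mathcal{F}_ju)(\boldsymbol{x}_j)$ are understood to be uniquely defined for $u\in\mathcal{H}$.
   Formalization: Two hypotheses are added, without which the claim fails: each g^(k) is continuous on S^(k), and for each k the points x_j with k_j = k (not merely all x_j lying in S^(k)) are dense in S^(k). *)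

theory Defs
  imports "HOL-Analysis.Analysis"
begin

primrec iter_partial :: "'a::real_vector list \<Rightarrow> ('a \<Rightarrow> complex) \<Rightarrow> 'a \<Rightarrow> complex" where
  "iter_partial [] u x = u x"
| "iter_partial (b # bs) u x = vector_derivative (\<lambda>t. iter_partial bs u (x + t *\<^sub>R b)) (at 0)"

primrec iter_partial_exists_on ::
    "'a::real_vector set \<Rightarrow> 'a list \<Rightarrow> ('a \<Rightarrow> complex) \<Rightarrow> bool" where
  "iter_partial_exists_on U [] u \<longleftrightarrow> True"
| "iter_partial_exists_on U (b # bs) u \<longleftrightarrow>
     iter_partial_exists_on U bs u \<and>
     (\<forall>x\<in>U. (\<lambda>t. iter_partial bs u (x + t *\<^sub>R b)) differentiable (at 0))"

(* The operator G u = (SUM w:W. c w * D_w u) on the open set U, acting on the functions in X.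
   Words w of coordinate directions replace multi-indices, since mixed partial derivatives need
   not commute under the bare existence assumption; the empty word gives the zeroth-order term.
   Only derivatives that occur in G have to exist, and nothing is assumed of the coefficients. *)
definition linear_differential_operator_on ::
    "'a::euclidean_space set \<Rightarrow> ('a \<Rightarrow> complex) set \<Rightarrow> (('a \<Rightarrow> complex) \<Rightarrow> 'a \<Rightarrow> complex) \<Rightarrow> bool"
  where
  "linear_differential_operator_on U X G \<longleftrightarrow>
     open U \<and>
     (\<exists>W c. finite W \<and> (\<forall>w\<in>W. set w \<subseteq> Basis) \<and>
        (\<forall>u\<in>X. \<forall>w\<in>W. iter_partial_exists_on U w u) \<and>
        (\<forall>u\<in>X. \<forall>x\<in>U. G u x = (\<Sum>w\<in>W. c w x * iter_partial w u x)))"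

definition hnorm :: "('f \<Rightarrow> 'f \<Rightarrow> complex) \<Rightarrow> 'f \<Rightarrow> real" where
  "hnorm ip u = sqrt (Re (ip u u))"

(* A complex Hilbert space whose elements are functions on \<Omega>. A function on \<Omega> is represented by
   its extension by zero, so that equality in H is equality on \<Omega>. *)
locale hilbert_function_space =
  fixes \<Omega> :: "'a set"
    and H :: "('a \<Rightarrow> complex) set"
    and ip :: "('a \<Rightarrow> complex) \<Rightarrow> ('a \<Rightarrow> complex) \<Rightarrow> complex"
  assumes zero_outside: "u \<in> H \<Longrightarrow> x \<notin> \<Omega> \<Longrightarrow> u x = 0"
    and zero_mem: "(\<lambda>x. 0) \<in> H"
    and add_mem: "u \<in> H \<Longrightarrow> v \<in> H \<Longrightarrow> (\<lambda>x. u x + v x) \<in> H"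
    and scale_mem: "u \<in> H \<Longrightarrow> (\<lambda>x. a * u x) \<in> H"
    and ip_add_left: "u \<in> H \<Longrightarrow> v \<in> H \<Longrightarrow> w \<in> H \<Longrightarrow> ip (\<lambda>x. u x + v x) w = ip u w + ip v w"
    and ip_scale_left: "u \<in> H \<Longrightarrow> v \<in> H \<Longrightarrow> ip (\<lambda>x. a * u x) v = a * ip u v"
    and ip_commute: "u \<in> H \<Longrightarrow> v \<in> H \<Longrightarrow> ip u v = cnj (ip v u)"
    and ip_pos: "u \<in> H \<Longrightarrow> u \<noteq> (\<lambda>x. 0) \<Longrightarrow> 0 < Re (ip u u)"
    and complete:
      "(\<And>n. X n \<in> H) \<Longrightarrow>
       (\<And>e. 0 < e \<Longrightarrow> \<exists>M. \<forall>m\<ge>M. \<forall>n\<ge>M. hnorm ip (\<lambda>x. X m x - X n x) < e) \<Longrightarrow>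
       \<exists>l\<in>H. (\<lambda>n. hnorm ip (\<lambda>x. X n x - l x)) \<longlonglongrightarrow> 0"

(* Boundedness of a linear map T from H to \<complex>^n, a vector being given by its entries 1..n. *)
definition bounded_into_Cn ::
    "'f set \<Rightarrow> ('f \<Rightarrow> 'f \<Rightarrow> complex) \<Rightarrow> nat \<Rightarrow> ('f \<Rightarrow> nat \<Rightarrow> complex) \<Rightarrow> bool" where
  "bounded_into_Cn H ip n T \<longleftrightarrow>
     (\<exists>C. \<forall>u\<in>H. L2_set (\<lambda>j. cmod (T u j)) {1..n} \<le> C * hnorm ip u)"

end

theory Submission
  imports Defs
begin

text \<open>By the parallelogram law, a minimal norm element \<open>u\<close> of a set \<open>A\<close> that is closed under
  midpoints satisfies \<open>\<parallel>v - u\<parallel>\<^sup>2 \<le> 2 (\<parallel>v\<parallel>\<^sup>2 - \<parallel>u\<parallel>\<^sup>2)\<close> for all \<open>v \<in> A\<close>. This gives uniqueness. As the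
  feasible sets decrease, the norms of the minimisers increase; being bounded, they converge, so the
  same inequality makes the minimisers a Cauchy sequence. Bounded point evaluations pass to
  the limit, and the equations extend from the dense set of points by continuity.\<close>

section \<open>Linearity of differential operators, and equality on a dense set\<close>

lemma iter_partial_lincomb:
  fixes u v :: "'a::real_normed_vector \<Rightarrow> complex"
  assumes "open U" and "iter_partial_exists_on U w u" and "iter_partial_exists_on U w v"
    and "y \<in> U"
  shows "iter_partial w (\<lambda>y. a * u y + b * v y) y = a * iter_partial w u y + b * iter_partial w v y"
  using assms(2-)
proof (induction w arbitrary: y)
  case Nil
  then show ?case by simp
next
  case (Cons d w)
  let ?h = "\<lambda>u t. iter_partial w u (y + t *\<^sub>R d)"
  let ?V = "(\<lambda>t. y + t *\<^sub>R d) -` U"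
  have "(?h u has_vector_derivative iter_partial (d # w) u y) (at 0)"
    "(?h v has_vector_derivative iter_partial (d # w) v y) (at 0)"
    using Cons.prems by (auto simp: vector_derivative_works)
  then have lin: "((\<lambda>t. a * ?h u t + b * ?h v t) has_vector_derivative
      (a * iter_partial (d # w) u y + b * iter_partial (d # w) v y)) (at 0)"
    by (intro has_vector_derivative_add has_vector_derivative_mult_right)
  \<comment> \<open>The induction hypothesis holds only at points of \<open>U\<close>. As
    \<open>U\<close> is open, \<open>y + t *\<^sub>R d\<close> stays in \<open>U\<close> for all
    \<open>t\<close> near 0, and a derivative at 0 depends on such \<open>t\<close> only.\<close>
  have "open ?V"
    by (intro open_vimage assms(1) continuous_intros)
  moreover have "0 \<in> ?V" using Cons.prems by simp
  moreover have "a * ?h u t + b * ?h v t = ?h (\<lambda>y. a * u y + b * v y) t" if "t \<in> ?V" for t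
    using Cons.IH[of "y + t *\<^sub>R d"] Cons.prems that by simp
  ultimately have "(?h (\<lambda>y. a * u y + b * v y) has_vector_derivative
      (a * iter_partial (d # w) u y + b * iter_partial (d # w) v y)) (at 0)"
    by (rule has_vector_derivative_transform_within_open[OF lin])
  then show ?case by (simp add: vector_derivative_at)
qed

text \<open>The coefficients depend on the point only, so linearity passes from the iterated partial
  derivatives to their weighted sum. The combination has to lie in \<open>X\<close>, because the
  formula for \<open>G\<close> is available only there.\<close>

lemma linear_differential_operator_on_lincomb:
  assumes "linear_differential_operator_on U X G"
    and "u \<in> X" "v \<in> X" "(\<lambda>y. a * u y + b * v y) \<in> X" "y \<in> U"
  shows "G (\<lambda>y. a * u y + b * v y) y = a * G u y + b * G v y"
proof -
  obtain W c where "open U" and ex: "\<And>u w. u \<in> X \<Longrightarrow> w \<in> W \<Longrightarrow> iter_partial_exists_on U w u"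
    and G: "\<And>u y. u \<in> X \<Longrightarrow> y \<in> U \<Longrightarrow> G u y = (\<Sum>w\<in>W. c w y * iter_partial w u y)"
    using assms(1) unfolding linear_differential_operator_on_def by metis
  have "G (\<lambda>y. a * u y + b * v y) y =
      (\<Sum>w\<in>W. c w y * (a * iter_partial w u y + b * iter_partial w v y))"
    using assms \<open>open U\<close> ex by (simp add: G iter_partial_lincomb)
  also have "\<dots> = a * G u y + b * G v y"
    using assms by (simp add: G sum_distrib_left algebra_simps sum.distrib)
  finally show ?thesis .
qed

text \<open>The zero set of \<open>h - k\<close> is closed relative to \<open>S\<close>, so it is
  the trace on \<open>S\<close> of a closed set \<open>T\<close>. This \<open>T\<close> contains
  \<open>D\<close>, hence \<open>closure D\<close>, hence \<open>S\<close>. The shape of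
  \<open>S\<close> does not matter.\<close>

lemma continuous_on_eq_on_dense:
  fixes h k :: "'a::topological_space \<Rightarrow> 'b::real_normed_vector"
  assumes "continuous_on S h" "continuous_on S k" "D \<subseteq> S" "S \<subseteq> closure D"
    and "\<And>y. y \<in> D \<Longrightarrow> h y = k y" and "y \<in> S"
  shows "h y = k y"
proof -
  have "closedin (top_of_set S) {y \<in> S. h y - k y = 0}"
    using assms by (intro continuous_closedin_preimage_constant continuous_on_diff)
  then obtain T where "closed T" and T: "{y \<in> S. h y - k y = 0} = S \<inter> T"
    unfolding closedin_closed by blast
  have "D \<subseteq> {y \<in> S. h y - k y = 0}" using assms by auto
  then have "closure D \<subseteq> T" using \<open>closed T\<close> T by (intro closure_minimal) auto
  then have "y \<in> {y \<in> S. h y - k y = 0}" using assms T by auto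
  then show ?thesis by simp
qed

section \<open>Inner product geometry and minimal norm elements\<close>

context hilbert_function_space
begin

lemma lincomb_mem: "u \<in> H \<Longrightarrow> v \<in> H \<Longrightarrow> (\<lambda>y. a * u y + b * v y) \<in> H"
  by (intro add_mem scale_mem)

lemma diff_mem: "u \<in> H \<Longrightarrow> v \<in> H \<Longrightarrow> (\<lambda>y. u y - v y) \<in> H"
  using lincomb_mem[of u v 1 "-1"] by simp

lemma ip_lincomb_left:
  "u \<in> H \<Longrightarrow> v \<in> H \<Longrightarrow> w \<in> H \<Longrightarrow> ip (\<lambda>y. a * u y + b * v y) w = a * ip u w + b * ip v w"
  by (simp add: ip_add_left ip_scale_left scale_mem)

lemma ip_lincomb_right:
  assumes "u \<in> H" "v \<in> H" "w \<in> H"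
  shows "ip w (\<lambda>y. a * u y + b * v y) = cnj a * ip w u + cnj b * ip w v"
  using assms lincomb_mem[OF assms(1,2), of a b]
  by (simp add: ip_commute[of w] ip_lincomb_left)

lemma ip_self_nonneg: "u \<in> H \<Longrightarrow> 0 \<le> Re (ip u u)"
  \<comment> \<open>Positivity is given for nonzero functions only; for the zero function, scaling
    by 0 makes the inner product vanish.\<close>
  using ip_pos[of u] ip_scale_left[OF zero_mem zero_mem, of 0] by fastforce

lemma hnorm_nonneg: "u \<in> H \<Longrightarrow> 0 \<le> hnorm ip u"
  by (simp add: hnorm_def ip_self_nonneg)

lemma hnorm_sq: "u \<in> H \<Longrightarrow> (hnorm ip u)\<^sup>2 = Re (ip u u)"
  by (simp add: hnorm_def ip_self_nonneg)

lemma hnorm_diff_eq_0: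
  assumes "u \<in> H" "v \<in> H" "hnorm ip (\<lambda>y. u y - v y) = 0"
  shows "u = v"
proof -
  have "Re (ip (\<lambda>y. u y - v y) (\<lambda>y. u y - v y)) = 0"
    using hnorm_sq[OF diff_mem[OF assms(1,2)]] assms(3) by simp
  then have "(\<lambda>y. u y - v y) = (\<lambda>y. 0)"
    using ip_pos[OF diff_mem[OF assms(1,2)]] by force
  then show ?thesis by (metis eq_iff_diff_eq_0 ext)
qed

text \<open>Both terms on the left are norms of combinations \<open>a * u + b * v\<close>, so one
  expansion serves for the coefficients 1, -1 and 1/2, 1/2. The midpoint replaces the usual sum,
  whence the factor 4, because midpoints of feasible functions are feasible.\<close>

lemma parallelogram_midpoint:
  assumes "u \<in> H" "v \<in> H"
  shows "(hnorm ip (\<lambda>y. u y - v y))\<^sup>2 + 4 * (hnorm ip (\<lambda>y. (1/2) * u y + (1/2) * v y))\<^sup>2 =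
    2 * (hnorm ip u)\<^sup>2 + 2 * (hnorm ip v)\<^sup>2"
proof -
  have "(hnorm ip (\<lambda>y. a * u y + b * v y))\<^sup>2 =
      Re (a * (cnj a * ip u u + cnj b * ip u v) + b * (cnj a * ip v u + cnj b * ip v v))" for a b
    using assms lincomb_mem[OF assms, of a b]
    by (simp add: hnorm_sq ip_lincomb_left ip_lincomb_right)
  from this[of 1 "-1"] this[of "1/2" "1/2"] show ?thesis
    using assms by (simp add: hnorm_sq algebra_simps)
qed

text \<open>Swapping \<open>u\<close> and \<open>v\<close> leaves every other term of the
  parallelogram identity unchanged.\<close>

lemma hnorm_diff_commute:
  assumes "u \<in> H" "v \<in> H"
  shows "hnorm ip (\<lambda>y. u y - v y) = hnorm ip (\<lambda>y. v y - u y)"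
proof -
  have "(hnorm ip (\<lambda>y. u y - v y))\<^sup>2 = (hnorm ip (\<lambda>y. v y - u y))\<^sup>2"
    using parallelogram_midpoint[OF assms] parallelogram_midpoint[OF assms(2,1)]
    by (simp add: add.commute)
  then show ?thesis
    using assms by (simp add: hnorm_nonneg diff_mem power2_eq_iff_nonneg)
qed

text \<open>The midpoint of \<open>v\<close> and \<open>u\<close> competes with \<open>u\<close>, so
  its norm is at least that of \<open>u\<close>; the parallelogram identity turns this lower bound
  into an upper bound on the distance.\<close>

lemma hnorm_diff_arg_min:
  assumes u: "is_arg_min (hnorm ip) (\<lambda>v. v \<in> A) u" and "v \<in> A" "A \<subseteq> H"
    and mid: "\<And>v w. v \<in> A \<Longrightarrow> w \<in> A \<Longrightarrow> (\<lambda>y. (1/2) * v y + (1/2) * w y) \<in> A"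
  shows "(hnorm ip (\<lambda>y. v y - u y))\<^sup>2 \<le> 2 * ((hnorm ip v)\<^sup>2 - (hnorm ip u)\<^sup>2)"
proof -
  have "u \<in> A" and min: "\<And>w. w \<in> A \<Longrightarrow> hnorm ip u \<le> hnorm ip w"
    using u by (auto simp: is_arg_min_def not_less)
  then have "hnorm ip u \<le> hnorm ip (\<lambda>y. (1/2) * v y + (1/2) * u y)"
    using mid \<open>v \<in> A\<close> by blast
  then have "(hnorm ip u)\<^sup>2 \<le> (hnorm ip (\<lambda>y. (1/2) * v y + (1/2) * u y))\<^sup>2"
    using \<open>u \<in> A\<close> \<open>A \<subseteq> H\<close> by (intro power_mono hnorm_nonneg) auto
  then show ?thesis
    using parallelogram_midpoint[of v u] \<open>u \<in> A\<close> \<open>v \<in> A\<close> \<open>A \<subseteq> H\<close> by (auto simp: subset_iff)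
qed

lemma arg_min_unique:
  assumes "is_arg_min (hnorm ip) (\<lambda>v. v \<in> A) u" "is_arg_min (hnorm ip) (\<lambda>v. v \<in> A) v" "A \<subseteq> H"
    and "\<And>v w. v \<in> A \<Longrightarrow> w \<in> A \<Longrightarrow> (\<lambda>y. (1/2) * v y + (1/2) * w y) \<in> A"
  shows "u = v"
proof -
  have mem: "u \<in> A" "v \<in> A"
    using assms(1,2) by (simp_all add: is_arg_min_def)
  then have "\<not> hnorm ip v < hnorm ip u" "\<not> hnorm ip u < hnorm ip v"
    using assms(1,2) unfolding is_arg_min_def by blast+
  then have eq: "hnorm ip u = hnorm ip v"
    by (simp only: not_less order.antisym)
  have "(hnorm ip (\<lambda>y. u y - v y))\<^sup>2 \<le> 2 * ((hnorm ip u)\<^sup>2 - (hnorm ip v)\<^sup>2)"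
    by (rule hnorm_diff_arg_min[OF assms(2) mem(1) assms(3,4)])
  then have "(hnorm ip (\<lambda>y. u y - v y))\<^sup>2 \<le> 0"
    unfolding eq by simp
  then show ?thesis
    using mem \<open>A \<subseteq> H\<close> by (intro hnorm_diff_eq_0) auto
qed

text \<open>Only convergence in \<open>H\<close> is claimed: the sets \<open>A n\<close> are not
  assumed closed, so the limit need not lie in them.\<close>

lemma arg_mins_converge:
  assumes u: "\<And>n. is_arg_min (hnorm ip) (\<lambda>v. v \<in> A n) (u n)"
    and "\<And>n. A n \<subseteq> H" and "decseq A"
    and mid: "\<And>n v w. v \<in> A n \<Longrightarrow> w \<in> A n \<Longrightarrow> (\<lambda>y. (1/2) * v y + (1/2) * w y) \<in> A n"
    and bound: "\<And>n. hnorm ip (u n) \<le> B"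
  shows "\<exists>l\<in>H. (\<lambda>n. hnorm ip (\<lambda>y. u n y - l y)) \<longlonglongrightarrow> 0"
proof (rule complete)
  have uA: "u n \<in> A n" for n
    using u by (simp add: is_arg_min_def)
  show uH: "u n \<in> H" for n
    using uA assms(2) by blast
  \<comment> \<open>A later minimiser satisfies the earlier constraints, so it can be compared with
    the earlier minimiser.\<close>
  have uA': "u m \<in> A n" if "n \<le> m" for m n
    using decseqD[OF \<open>decseq A\<close> that] uA by blast
  define s where "s n = (hnorm ip (u n))\<^sup>2" for n
  have diff: "(hnorm ip (\<lambda>y. u m y - u n y))\<^sup>2 \<le> 2 * (s m - s n)" if "n \<le> m" for m n
    unfolding s_def using hnorm_diff_arg_min[OF u uA'[OF that] assms(2) mid] .
  have "incseq s"
  proof (rule incseq_SucI)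
    fix n show "s n \<le> s (Suc n)"
      using order_trans[OF zero_le_power2 diff[of n "Suc n"]] by simp
  qed
  moreover have "s n \<le> B\<^sup>2" for n
    unfolding s_def using bound uH by (intro power_mono hnorm_nonneg)
  ultimately have "Cauchy s"
    by (metis incseq_convergent LIMSEQ_imp_Cauchy)
  fix e :: real
  assume "0 < e"
  \<comment> \<open>The choice \<open>e\<^sup>2 / 2\<close> cancels the factor 2 in
    \<open>diff\<close>.\<close>
  then obtain M where M: "\<And>m n. m \<ge> M \<Longrightarrow> n \<ge> M \<Longrightarrow> dist (s m) (s n) < e\<^sup>2 / 2"
    using \<open>Cauchy s\<close> unfolding Cauchy_def by (metis half_gt_zero zero_less_power)
  have less: "hnorm ip (\<lambda>y. u m y - u n y) < e" if "n \<ge> M" "n \<le> m" for m n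
  proof -
    have "s m - s n < e\<^sup>2 / 2"
      using M[of m n] that by (auto simp only: dist_real_def abs_less_iff)
    then have "2 * (s m - s n) < e\<^sup>2"
      by (simp only: less_divide_eq_numeral1 mult.commute)
    then have "(hnorm ip (\<lambda>y. u m y - u n y))\<^sup>2 < e\<^sup>2"
      by (rule order.strict_trans1[OF diff[OF that(2)]])
    then show ?thesis using \<open>0 < e\<close> power2_less_imp_less less_imp_le by blast
  qed
  have "hnorm ip (\<lambda>y. u m y - u n y) < e" if "m \<ge> M" "n \<ge> M" for m n
    using less[of n m] less[of m n] hnorm_diff_commute[OF uH[of m] uH[of n]] that
    by (cases "n \<le> m") auto
  then show "\<exists>M. \<forall>m\<ge>M. \<forall>n\<ge>M. hnorm ip (\<lambda>y. u m y - u n y) < e" by blast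
qed

end

section \<open>Interpolation at the sample points and passage to the limit\<close>

theorem proposition2:
  fixes \<Omega> :: "'a::euclidean_space set"
    and H :: "('a \<Rightarrow> complex) set"
    and ip :: "('a \<Rightarrow> complex) \<Rightarrow> ('a \<Rightarrow> complex) \<Rightarrow> complex"
    and N\<^sub>S :: nat
    and S :: "nat \<Rightarrow> 'a set"
    and G :: "nat \<Rightarrow> ('a \<Rightarrow> complex) \<Rightarrow> 'a \<Rightarrow> complex"
    and g :: "nat \<Rightarrow> 'a \<Rightarrow> complex"
    and x :: "nat \<Rightarrow> 'a"
    and \<kappa> :: "nat \<Rightarrow> nat"
    and F :: "nat \<Rightarrow> ('a \<Rightarrow> complex) \<Rightarrow> 'a \<Rightarrow> complex"
    and f :: "nat \<Rightarrow> complex"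
    and L :: "nat \<Rightarrow> ('a \<Rightarrow> complex) \<Rightarrow> nat \<Rightarrow> complex"
  assumes "open \<Omega>" and "connected \<Omega>"
    and "hilbert_function_space \<Omega> H ip"
    and "\<And>k. k \<in> {1..N\<^sub>S} \<Longrightarrow> S k \<subseteq> \<Omega>"
    and "\<And>k. k \<in> {1..N\<^sub>S} \<Longrightarrow>
           \<exists>U. S k \<subseteq> U \<and> U \<subseteq> \<Omega> \<and> linear_differential_operator_on U H (G k)"
    and "\<And>k. k \<in> {1..N\<^sub>S} \<Longrightarrow> continuous_on (S k) (g k)"
    and "\<And>j. j \<ge> 1 \<Longrightarrow> \<kappa> j \<in> {1..N\<^sub>S}"
    and "\<And>j. j \<ge> 1 \<Longrightarrow> x j \<in> S (\<kappa> j)"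
    and "\<And>k. k \<in> {1..N\<^sub>S} \<Longrightarrow> S k \<subseteq> closure {x j |j. j \<ge> 1 \<and> \<kappa> j = k}"
    and "\<And>j. j \<ge> 1 \<Longrightarrow> F j = G (\<kappa> j)"
    and "\<And>j. j \<ge> 1 \<Longrightarrow> f j = g (\<kappa> j) (x j)"
    and "\<And>N u j. N \<ge> 1 \<Longrightarrow> u \<in> H \<Longrightarrow> j \<in> {1..N} \<Longrightarrow> L N u j = F j u (x j)"
    and "\<And>N. N \<ge> 1 \<Longrightarrow> bounded_into_Cn H ip N (L N)"
    and "\<And>k u. k \<in> {1..N\<^sub>S} \<Longrightarrow> u \<in> H \<Longrightarrow> continuous_on (S k) (G k u)"
  shows "(\<forall>N\<ge>1. \<exists>\<^sub>\<le>\<^sub>1 v. is_arg_min (hnorm ip) (\<lambda>v. v \<in> H \<and> (\<forall>j\<in>{1..N}. F j v (x j) = f j)) v) \<and>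
    (\<forall>u B. B > 0 \<longrightarrow>
       (\<forall>N\<ge>1. is_arg_min (hnorm ip) (\<lambda>v. v \<in> H \<and> (\<forall>j\<in>{1..N}. F j v (x j) = f j)) (u N) \<and>
               hnorm ip (u N) < B) \<longrightarrow>
       (\<exists>u_inf\<in>H. (\<forall>k\<in>{1..N\<^sub>S}. \<forall>y\<in>S k. G k u_inf y = g k y) \<and>
          (\<lambda>N. hnorm ip (\<lambda>y. u_inf y - u N y)) \<longlonglongrightarrow> 0))"
proof -
  interpret hilbert_function_space \<Omega> H ip by fact
  define A where "A N = {v \<in> H. \<forall>j\<in>{1..N}. F j v (x j) = f j}" for N
  have AH: "A N \<subseteq> H" for N
    by (auto simp: A_def)
  \<comment> \<open>The operator is known to be linear only at points of a neighbourhood of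
    \<open>S (\<kappa> j)\<close>, which contains \<open>x j\<close>.\<close>
  have lin: "F j (\<lambda>y. a * v y + b * w y) (x j) = a * F j v (x j) + b * F j w (x j)"
    if j: "j \<ge> 1" and "v \<in> H" "w \<in> H" for j v w a b
  proof -
    obtain U where "S (\<kappa> j) \<subseteq> U" and U: "linear_differential_operator_on U H (G (\<kappa> j))"
      using assms(5)[OF assms(7)[OF j]] by blast
    then have "x j \<in> U" using assms(8)[OF j] by blast
    then show ?thesis
      using linear_differential_operator_on_lincomb[OF U] that lincomb_mem by (simp add: assms(10))
  qed
  have mid: "(\<lambda>y. (1/2) * v y + (1/2) * w y) \<in> A N" if "v \<in> A N" "w \<in> A N" for N v w
  proof -
    have "v \<in> H" "w \<in> H" using that by (auto simp: A_def)
    moreover have "F j v (x j) = f j" "F j w (x j) = f j" if "j \<in> {1..N}" for j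
      using \<open>v \<in> A N\<close> \<open>w \<in> A N\<close> that by (auto simp: A_def)
    ultimately have "F j (\<lambda>y. (1/2) * v y + (1/2) * w y) (x j) = f j" if "j \<in> {1..N}" for j
      using lin[of j v w "1/2" "1/2"] that by simp
    then show ?thesis
      using \<open>v \<in> H\<close> \<open>w \<in> H\<close> lincomb_mem unfolding A_def by blast
  qed
  have constraint: "(v \<in> H \<and> (\<forall>j\<in>{1..N}. F j v (x j) = f j)) \<longleftrightarrow> v \<in> A N" for v N
    by (simp add: A_def)
  have solution: "\<exists>l\<in>H. (\<forall>k\<in>{1..N\<^sub>S}. \<forall>y\<in>S k. G k l y = g k y) \<and>
      (\<lambda>N. hnorm ip (\<lambda>y. l y - u N y)) \<longlonglongrightarrow> 0"
    if u: "\<And>N. N \<ge> 1 \<Longrightarrow> is_arg_min (hnorm ip) (\<lambda>v. v \<in> A N) (u N)"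
      and B: "\<And>N. N \<ge> 1 \<Longrightarrow> hnorm ip (u N) < B" for u B
  proof -
    \<comment> \<open>The index is shifted because nothing is known of \<open>u 0\<close>.\<close>
    have "decseq (\<lambda>n. A (Suc n))"
      by (auto simp: A_def decseq_def)
    then have "\<exists>l\<in>H. (\<lambda>n. hnorm ip (\<lambda>y. u (Suc n) y - l y)) \<longlonglongrightarrow> 0"
      by (intro arg_mins_converge[where A = "\<lambda>n. A (Suc n)" and B = B])
        (use u AH mid B in \<open>auto intro: less_imp_le\<close>)
    then obtain l where "l \<in> H" and lim: "(\<lambda>n. hnorm ip (\<lambda>y. u (Suc n) y - l y)) \<longlonglongrightarrow> 0"
      by blast
    have uA: "u N \<in> A N" if "N \<ge> 1" for N
      using u[OF that] by (simp add: is_arg_min_def)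
    have eq: "F j l (x j) = f j" if "j \<ge> 1" for j
    proof -
      \<comment> \<open>\<open>L j\<close> stays fixed while \<open>n\<close> grows, so a single
        \<open>C\<close> serves all \<open>n\<close>. For \<open>n \<ge> j\<close> the function
        \<open>u (Suc n)\<close> already satisfies constraint \<open>j\<close>, so the error of
        \<open>l\<close> there is an entry of \<open>L j\<close> applied to the difference.\<close>
      obtain C where C: "\<And>v. v \<in> H \<Longrightarrow> L2_set (\<lambda>i. cmod (L j v i)) {1..j} \<le> C * hnorm ip v"
        using assms(13)[OF \<open>j \<ge> 1\<close>] unfolding bounded_into_Cn_def by blast
      have "cmod (f j - F j l (x j)) \<le> C * hnorm ip (\<lambda>y. u (Suc n) y - l y)" if "n \<ge> j" for n
      proof -
        let ?d = "\<lambda>y. u (Suc n) y - l y"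
        have uH: "u (Suc n) \<in> H" and "F j (u (Suc n)) (x j) = f j"
          using uA[of "Suc n"] \<open>j \<ge> 1\<close> \<open>n \<ge> j\<close> by (auto simp: A_def)
        then have "L j ?d j = f j - F j l (x j)"
          using lin[OF \<open>j \<ge> 1\<close> uH \<open>l \<in> H\<close>, of 1 "-1"] assms(12)[of j ?d j] \<open>j \<ge> 1\<close> \<open>l \<in> H\<close>
          by (simp add: diff_mem)
        then show ?thesis
          using member_le_L2_set[of "{1..j}" j "\<lambda>i. cmod (L j ?d i)"] C[of ?d] \<open>j \<ge> 1\<close> uH \<open>l \<in> H\<close>
          by (simp add: diff_mem)
      qed
      moreover have "(\<lambda>n. C * hnorm ip (\<lambda>y. u (Suc n) y - l y)) \<longlonglongrightarrow> 0"
        using tendsto_mult_right_zero[OF lim] by simp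
      ultimately have "cmod (f j - F j l (x j)) \<le> 0"
        by (intro LIMSEQ_le_const) auto
      then show ?thesis by simp
    qed
    \<comment> \<open>Among the sample points in \<open>S k\<close>, those labelled \<open>k\<close>
      prescribe the value of \<open>G k l\<close>. They are dense in \<open>S k\<close>, and
      continuity of both \<open>G k l\<close> and \<open>g k\<close> carries the equation to the
      rest of \<open>S k\<close>.\<close>
    have "G k l y = g k y" if k: "k \<in> {1..N\<^sub>S}" and "y \<in> S k" for k y
    proof (rule continuous_on_eq_on_dense[of "S k" "G k l" "g k" "{x j |j. j \<ge> 1 \<and> \<kappa> j = k}"])
      show "{x j |j. j \<ge> 1 \<and> \<kappa> j = k} \<subseteq> S k"
        using assms(8) by blast
      show "G k l z = g k z" if "z \<in> {x j |j. j \<ge> 1 \<and> \<kappa> j = k}" for z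
        using that eq assms(10,11) by force
    qed (use assms(6,9,14)[OF k] \<open>l \<in> H\<close> \<open>y \<in> S k\<close> in auto)
    \<comment> \<open>Completeness gives the difference in the opposite order; after the swap,
      \<open>LIMSEQ_imp_Suc\<close> undoes the index shift.\<close>
    moreover have "hnorm ip (\<lambda>y. u (Suc n) y - l y) = hnorm ip (\<lambda>y. l y - u (Suc n) y)" for n
      using uA[of "Suc n"] AH \<open>l \<in> H\<close> by (intro hnorm_diff_commute) auto
    then have "(\<lambda>N. hnorm ip (\<lambda>y. l y - u N y)) \<longlonglongrightarrow> 0"
      using lim by (simp add: LIMSEQ_imp_Suc[of "\<lambda>N. hnorm ip (\<lambda>y. l y - u N y)"])
    ultimately show ?thesis using \<open>l \<in> H\<close> by blast
  qed
  show ?thesis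
    unfolding constraint
  proof (intro conjI allI impI)
    show "\<exists>\<^sub>\<le>\<^sub>1 v. is_arg_min (hnorm ip) (\<lambda>v. v \<in> A N) v" for N
      by (intro Uniq_I arg_min_unique[where A = "A N"] AH mid)
    fix u B
    assume "\<forall>N\<ge>1. is_arg_min (hnorm ip) (\<lambda>v. v \<in> A N) (u N) \<and> hnorm ip (u N) < B"
    then show "\<exists>l\<in>H. (\<forall>k\<in>{1..N\<^sub>S}. \<forall>y\<in>S k. G k l y = g k y) \<and>
        (\<lambda>N. hnorm ip (\<lambda>y. l y - u N y)) \<longlonglongrightarrow> 0"
      by (intro solution[of u B]) auto
  qed
qed

end
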